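(* Let $X \subset A^{\mathbb{Z}}$ and $Y \subset B^{\mathbb{Z}}$ (with $A, B$ finite alphabets) be infinite topologically transitive subshifts of finite type, and let $X' \subset X$ and $Y' \subset Y$ be their subsets of non-periodic points. Then for every topological conjugacy $\phi' : X' \to Y'$ there exists a topological conjugacy $\phi : X \to Y$ such that $\phi'$ is the domain-codomain restriction of $\phi$ (i.e. $\phi(x) = \phi'(x)$ for all $x \in X'$), and this $\phi$ is unique.
   Context: For a finite alphabet $A$, $A^{\mathbb{Z}}$ carries the product topology of the discrete topology, and the shift is $\sigma(x)_i = x_{i+1}$. A word $u \in A^*$ occurs in $x \in A^{\mathbb{Z}}$, written $u \sqsubset x$, if $x_{[i,i+|u|-1]} = u$ for some $i \in \mathbb{Z}$; for $X \subset A^{\mathbb{Z}}$, $u \sqsubset X$ means $u \sqsubset x$ for some $x \in X$. A subshift is a set $X = \{x \in A^{\mathbb{Z}} \mid \forall u \in F: u \not\sqsubset x\}$ for some set $F \subset A^*$ of forbidden words (equivalently, a closed $\sigma$-invariant set); it is a subshift of finite type (SFT) if $F$ can be chosen finite. A subshift $X$ is (topologically) transitive if for all $u, v \sqsubset X$ there is a word $w$ with $uwv \sqsubset X$. A point $x$ is periodic if $\sigma^n(x) = x$ for some $n > 0$. For a subshift $X$, $X' = \{x \in X \mid x \text{ is not periodic}\}$, with the subspace topology and the restriction of $\sigma$ (in general non-compact). A topological conjugacy between two such systems (subshifts, or subshifts with the periodic points removed) is a homeomorphism commuting with $\sigma$. *)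

theory Defs
  imports "HOL-Analysis.Analysis"
begin

(* An alphabet is a finite type 'a; the configuration space is the whole type int => 'a. *)

definition full_shift :: "(int \<Rightarrow> 'a) topology" where
  "full_shift = product_topology (\<lambda>_. discrete_topology UNIV) UNIV"

lemma topspace_full_shift [simp]: "topspace full_shift = UNIV"
  by (simp add: full_shift_def)

definition shift :: "(int \<Rightarrow> 'a) \<Rightarrow> int \<Rightarrow> 'a" where
  "shift x = (\<lambda>i. x (i + 1))"

definition occurs :: "'a list \<Rightarrow> (int \<Rightarrow> 'a) \<Rightarrow> bool" where
  "occurs u x \<longleftrightarrow> (\<exists>i. \<forall>k < length u. x (i + int k) = u ! k)"

definition occurs_in :: "'a list \<Rightarrow> (int \<Rightarrow> 'a) set \<Rightarrow> bool" where
  "occurs_in u X \<longleftrightarrow> (\<exists>x\<in>X. occurs u x)"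

definition avoiding :: "'a list set \<Rightarrow> (int \<Rightarrow> 'a) set" where
  "avoiding F = {x. \<forall>u\<in>F. \<not> occurs u x}"

definition subshift_of_finite_type :: "(int \<Rightarrow> 'a::finite) set \<Rightarrow> bool" where
  "subshift_of_finite_type X \<longleftrightarrow> (\<exists>F. finite F \<and> X = avoiding F)"

definition transitive_shift :: "(int \<Rightarrow> 'a) set \<Rightarrow> bool" where
  "transitive_shift X \<longleftrightarrow>
     (\<forall>u v. occurs_in u X \<and> occurs_in v X \<longrightarrow> (\<exists>w. occurs_in (u @ w @ v) X))"

definition periodic :: "(int \<Rightarrow> 'a) \<Rightarrow> bool" where
  "periodic x \<longleftrightarrow> (\<exists>n>0. (shift ^^ n) x = x)"

definition nonperiodic_part :: "(int \<Rightarrow> 'a) set \<Rightarrow> (int \<Rightarrow> 'a) set" where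
  "nonperiodic_part X = {x \<in> X. \<not> periodic x}"

(* Only the values of f on X matter; X and Y carry the subspace topology. *)
definition conjugacy ::
  "(int \<Rightarrow> 'a) set \<Rightarrow> (int \<Rightarrow> 'b) set \<Rightarrow> ((int \<Rightarrow> 'a) \<Rightarrow> (int \<Rightarrow> 'b)) \<Rightarrow> bool" where
  "conjugacy X Y f \<longleftrightarrow>
     homeomorphic_map (subtopology full_shift X) (subtopology full_shift Y) f \<and>
     (\<forall>x\<in>X. f (shift x) = shift (f x))"

end

theory Submission
  imports Defs "HOL-Library.Diagonal_Subsequence"
begin

text \<open>
  Compactness, together with continuity of the inverse of \<open>\<phi>'\<close>, shows that as nonperiodic points
  tend to a periodic point \<open>p\<close>, their images accumulate only at periodic points. For a fixed period
  these accumulation points form a compact invariant set of periodic points and so have a common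
  period. Thus \<open>\<phi>'\<close> maps a long piece of \<open>p\<close> inside a nonperiodic point to a long piece of a periodic
  point \<open>q\<close>.

  The point \<open>q\<close> depends only on \<open>p\<close>. If \<open>x\<close> is right asymptotic and \<open>y\<close> is left asymptotic to \<open>p\<close>,
  the spliced points \<open>x p p \<dots> p y\<close> are in \<open>X\<close> and infinitely often nonperiodic, so the images of \<open>x\<close>
  and of \<open>y\<close> have the same tail. A point that contains only a finite piece of \<open>p\<close> is, seen from the
  right end of this piece, close to a nonperiodic point left asymptotic to \<open>p\<close>, which gives the same
  \<open>q\<close> again. Hence \<open>\<phi>'\<close> is uniformly continuous, given by a sliding block code, and extends to \<open>X\<close>;
  so does its inverse, and density of the nonperiodic points does the rest.
\<close>

section \<open>Pointwise convergence in the full shift\<close>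

text \<open>The powers of \<open>shift\<close> with exponents in the integers, so that a point can
  be moved in both directions.\<close>

definition translate :: "int \<Rightarrow> (int \<Rightarrow> 'a) \<Rightarrow> int \<Rightarrow> 'a" where
  "translate n x = (\<lambda>i. x (i + n))"

text \<open>Convergence in \<open>full_shift\<close>, by \<open>limitin_full_shift\<close>. The
  dynamical arguments use only sequences and finite windows.\<close>

definition converges :: "(nat \<Rightarrow> int \<Rightarrow> 'a) \<Rightarrow> (int \<Rightarrow> 'a) \<Rightarrow> bool" where
  "converges u x \<longleftrightarrow> (\<forall>i. \<forall>\<^sub>F n in sequentially. u n i = x i)"

lemma translate_apply [simp]: "translate n x i = x (i + n)"
  by (simp add: translate_def)

lemma translate_translate [simp]: "translate m (translate n x) = translate (m + n) x"
  by (auto simp: fun_eq_iff add_ac)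

lemma translate_zero [simp]: "translate 0 x = x"
  by (simp add: fun_eq_iff)

lemma shift_eq_translate: "shift = translate 1"
  by (simp add: shift_def translate_def fun_eq_iff)

lemma funpow_shift: "(shift ^^ n) x = translate (int n) x"
  by (induction n arbitrary: x) (auto simp: shift_def fun_eq_iff add_ac)

section \<open>Periods and periodic points\<close>

lemma period_mult:
  fixes x :: "int \<Rightarrow> 'a"
  assumes "\<And>i. x (i + k) = x i"
  shows "x (i + m * k) = x i"
proof -
  have *: "x (i + int n * k) = x i" for n i
  proof (induction n)
    case (Suc n)
    then show ?case using assms[of "i + int n * k"] by (simp add: algebra_simps)
  qed simp
  show ?thesis
  proof (cases "m \<ge> 0")
    case True
    then show ?thesis using *[of i "nat m"] by simp
  next
    case False
    then show ?thesis using *[of "i + m * k" "nat (- m)"] by simp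
  qed
qed

lemma periodic_iff: "periodic x \<longleftrightarrow> (\<exists>k>0. \<forall>i. x (i + k) = x i)"
proof
  assume "\<exists>k>0. \<forall>i. x (i + k) = x i"
  then obtain k where "k > 0" "\<forall>i. x (i + k) = x i" by blast
  then have "nat k > 0 \<and> (shift ^^ nat k) x = x"
    by (simp add: funpow_shift fun_eq_iff)
  then show "periodic x" unfolding periodic_def by blast
next
  assume "periodic x"
  then obtain n where "n > 0" "translate (int n) x = x"
    by (auto simp: periodic_def funpow_shift)
  then have "int n > 0 \<and> (\<forall>i. x (i + int n) = x i)"
    by (metis of_nat_0_less_iff translate_apply)
  then show "\<exists>k>0. \<forall>i. x (i + k) = x i" by blast
qed

lemma periodic_translate [simp]: "periodic (translate n x) \<longleftrightarrow> periodic x"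
proof -
  have *: "periodic (translate n x)" if "periodic x" for n and x :: "int \<Rightarrow> 'a"
    using that unfolding periodic_iff by (metis add.commute add.left_commute translate_apply)
  then show ?thesis using *[of "translate n x" "- n"] *[of x n] by auto
qed

lemma common_period:
  assumes "periodic x" "periodic y"
  obtains k where "k > 0" "\<And>i. x (i + k) = x i" "\<And>i. y (i + k) = y i"
proof -
  obtain k l where kl: "k > 0" "\<forall>i. x (i + k) = x i" "l > 0" "\<forall>i. y (i + l) = y i"
    using assms unfolding periodic_iff by blast
  show thesis
  proof
    show "k * l > 0" using kl by simp
    show "x (i + k * l) = x i" for i using period_mult[of x k i l] kl by (simp add: mult.commute)
    show "y (i + k * l) = y i" for i using period_mult[of y l i k] kl by simp
  qed
qed

text \<open>A multiple of a common period carries any coordinate into the half-line where the two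
  points agree. This is the main device for proving points nonperiodic.\<close>

lemma periodic_eq_left:
  assumes "periodic x" "periodic y" and eq: "\<And>j. j < a \<Longrightarrow> x j = y j"
  shows "x = y"
proof
  fix i
  obtain k where k: "k > 0" "\<And>i. x (i + k) = x i" "\<And>i. y (i + k) = y i"
    using common_period assms by blast
  have "\<bar>i - a\<bar> * k \<ge> \<bar>i - a\<bar>" using k(1) mult_left_mono[of 1 k "\<bar>i - a\<bar>"] by simp
  then have "i + (- \<bar>i - a\<bar> - 1) * k < a" using k(1) by (simp add: algebra_simps)
  then show "x i = y i"
    using eq period_mult[of x k i "- \<bar>i - a\<bar> - 1"] period_mult[of y k i "- \<bar>i - a\<bar> - 1"] k
    by simp
qed

lemma periodic_eq_right:
  assumes "periodic x" "periodic y" and eq: "\<And>j. j \<ge> a \<Longrightarrow> x j = y j"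
  shows "x = y"
proof
  fix i
  obtain k where k: "k > 0" "\<And>i. x (i + k) = x i" "\<And>i. y (i + k) = y i"
    using common_period assms by blast
  have "\<bar>i - a\<bar> * k \<ge> \<bar>i - a\<bar>" using k(1) mult_left_mono[of 1 k "\<bar>i - a\<bar>"] by simp
  then have "i + \<bar>i - a\<bar> * k \<ge> a" by linarith
  then show "x i = y i"
    using eq period_mult[of x k i "\<bar>i - a\<bar>"] period_mult[of y k i "\<bar>i - a\<bar>"] k
    by simp
qed

section \<open>Convergent sequences and compactness\<close>

lemma converges_window:
  assumes "converges u x"
  shows "\<forall>\<^sub>F n in sequentially. \<forall>i\<in>{a..b}. u n i = x i"
  using assms by (simp add: converges_def eventually_ball_finite_distrib)

lemma converges_subseq:
  assumes "converges u x" "strict_mono r"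
  shows "converges (u \<circ> r) x"
  using assms eventually_subseq[of r] unfolding converges_def by auto

lemma convergesI_window:
  assumes "\<And>n i. i \<in> {- int n..int n} \<Longrightarrow> u n i = x i"
  shows "converges u x"
  unfolding converges_def
proof
  fix i
  have "u n i = x i" if "n \<ge> nat \<bar>i\<bar>" for n using that by (intro assms) auto
  then show "\<forall>\<^sub>F n in sequentially. u n i = x i"
    unfolding eventually_sequentially by blast
qed

lemma converges_unique:
  assumes "converges u x" "converges u y"
  shows "x = y"
proof
  fix i
  have "\<forall>\<^sub>F n in sequentially. u n i = x i \<and> u n i = y i"
    using assms by (simp add: converges_def eventually_conj)
  then have "\<exists>n. u n i = x i \<and> u n i = y i"
    by (rule eventually_happens'[OF sequentially_bot])
  then show "x i = y i" by auto
qed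

lemma convergent_subsequence:
  fixes u :: "nat \<Rightarrow> int \<Rightarrow> 'a::finite"
  obtains r x where "strict_mono r" "converges (u \<circ> r) x"
proof -
  \<comment> \<open>Diagonal argument over the coordinates, enumerated by \<open>int_decode\<close>:
    \<open>P n\<close> says that coordinate number \<open>n\<close> is constant along the
    subsequence, which the pigeonhole principle achieves over a finite alphabet.\<close>
  define P where "P n s \<longleftrightarrow> (\<exists>a. \<forall>k. u (s k) (int_decode n) = a)" for n and s :: "nat \<Rightarrow> nat"
  interpret subseqs P
  proof
    fix n and s :: "nat \<Rightarrow> nat"
    assume "strict_mono s"
    have "\<exists>a. infinite {k \<in> UNIV. u (s k) (int_decode n) = a}"
      using pigeonhole_infinite[of "UNIV :: nat set" "\<lambda>k. u (s k) (int_decode n)"] by auto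
    then obtain a where a: "infinite {k. u (s k) (int_decode n) = a}" by auto
    obtain r :: "nat \<Rightarrow> nat" where "strict_mono r" "\<forall>k. r k \<in> {k. u (s k) (int_decode n) = a}"
      using infinite_enumerate[OF a] by blast
    then show "\<exists>r'. strict_mono r' \<and> P n (s \<circ> r')" by (auto simp: P_def)
  qed
  have P: "P k (diagseq \<circ> (+) (Suc k))" for k
    by (rule diagseq_holds) (auto simp: P_def)
  have "\<exists>a. \<forall>k. u (diagseq (Suc (int_encode i) + k)) i = a" for i
    using P[of "int_encode i"] by (simp add: P_def)
  then obtain x where x: "\<And>i k. u (diagseq (Suc (int_encode i) + k)) i = x i" by metis
  have "converges (u \<circ> diagseq) x"
    unfolding converges_def
  proof
    fix i
    have "(u \<circ> diagseq) k i = x i" if "k \<ge> Suc (int_encode i)" for k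
      using x[of i "k - Suc (int_encode i)"] that by simp
    then show "\<forall>\<^sub>F k in sequentially. (u \<circ> diagseq) k i = x i"
      unfolding eventually_sequentially by blast
  qed
  then show thesis using that subseq_diagseq by blast
qed

section \<open>The product topology in terms of sequences and windows\<close>

lemma limitin_full_shift: "limitin full_shift u x sequentially \<longleftrightarrow> converges u x"
  unfolding full_shift_def limitin_componentwise converges_def
proof (simp, intro all_cong1)
  fix i
  show "limitin (discrete_topology UNIV) (\<lambda>c. u c i) (x i) sequentially \<longleftrightarrow>
      (\<forall>\<^sub>F n in sequentially. u n i = x i)"
  proof
    assume "limitin (discrete_topology UNIV) (\<lambda>c. u c i) (x i) sequentially"
    then show "\<forall>\<^sub>F n in sequentially. u n i = x i"
      by (auto simp: limitin_def dest!: spec[of _ "{x i}"])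
  qed (auto simp: limitin_def elim: eventually_mono)
qed

lemma continuous_map_converges:
  assumes f: "continuous_map (subtopology full_shift X) (subtopology full_shift Y) f"
    and u: "converges u x" "\<And>n. u n \<in> X" and x: "x \<in> X"
  shows "converges (f \<circ> u) (f x)"
proof -
  have "limitin (subtopology full_shift X) u x sequentially"
    using u x by (simp add: limitin_subtopology limitin_full_shift)
  then have "limitin (subtopology full_shift Y) (f \<circ> u) (f x) sequentially"
    by (rule continuous_map_limit[OF f])
  then show ?thesis by (simp add: limitin_subtopology limitin_full_shift)
qed

text \<open>The easy half of the Curtis-Hedlund-Lyndon theorem: around each point, the finite
  cylinder on the window lies inside the preimage. The window may depend on the coordinate.\<close>

lemma continuous_map_sliding_block:
  assumes maps: "f ` X \<subseteq> Y"
    and loc: "\<And>i. \<exists>a b. \<forall>x\<in>X. \<forall>y\<in>X. (\<forall>j\<in>{a..b::int}. x j = y j) \<longrightarrow> f x i = f y i"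
  shows "continuous_map (subtopology full_shift X) (subtopology full_shift Y) f"
proof -
  have "continuous_map (subtopology full_shift X) (discrete_topology UNIV) (\<lambda>x. f x i)" for i
  proof -
    obtain a b where ab: "\<And>x y. x \<in> X \<Longrightarrow> y \<in> X \<Longrightarrow> (\<forall>j\<in>{a..b::int}. x j = y j) \<Longrightarrow> f x i = f y i"
      using loc[of i] by blast
    have "openin (subtopology full_shift X) {x \<in> X. f x i \<in> U}" for U
    proof (subst openin_subopen, intro ballI)
      fix x assume x: "x \<in> {x \<in> X. f x i \<in> U}"
      let ?W = "{y. \<forall>j\<in>{a..b}. y j = x j}"
      have "openin full_shift {y. y j = x j}" for j
        using openin_continuous_map_preimage
            [OF continuous_map_product_projection[of j UNIV "\<lambda>_. discrete_topology UNIV"], of "{x j}"]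
        unfolding full_shift_def by simp
      then have "openin full_shift (topspace full_shift \<inter> (\<Inter>j\<in>{a..b}. {y. y j = x j}))"
        using openin_topspace[of full_shift] by (intro openin_Int_Inter) auto
      moreover have "topspace full_shift \<inter> (\<Inter>j\<in>{a..b}. {y. y j = x j}) = ?W" by auto
      ultimately have "openin full_shift ?W" by simp
      then have "openin (subtopology full_shift X) (X \<inter> ?W)"
        by (simp add: openin_subtopology_Int2)
      moreover have "X \<inter> ?W \<subseteq> {x \<in> X. f x i \<in> U}"
      proof
        fix y assume y: "y \<in> X \<inter> ?W"
        then have "f y i = f x i" using x by (intro ab) auto
        then show "y \<in> {x \<in> X. f x i \<in> U}" using x y by simp
      qed
      ultimately show "\<exists>T. openin (subtopology full_shift X) T \<and> x \<in> T \<and> T \<subseteq> {x \<in> X. f x i \<in> U}"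
        using x by (intro exI[of _ "X \<inter> ?W"]) auto
    qed
    then show ?thesis by (simp add: continuous_map_def)
  qed
  then have "continuous_map (subtopology full_shift X) full_shift f"
    unfolding full_shift_def continuous_map_componentwise_UNIV by blast
  then show ?thesis using maps by (auto simp: continuous_map_in_subtopology)
qed


section \<open>Shifts of finite type\<close>

lemma occurs_translate [simp]: "occurs u (translate n x) \<longleftrightarrow> occurs u x"
proof -
  have *: "occurs u (translate n x)" if "occurs u x" for n and x :: "int \<Rightarrow> 'a"
  proof -
    obtain i where i: "\<forall>k < length u. x (i + int k) = u ! k"
      using \<open>occurs u x\<close> unfolding occurs_def by blast
    then have "\<forall>k < length u. translate n x (i - n + int k) = u ! k"
      by (simp add: algebra_simps)
    then show ?thesis unfolding occurs_def by blast
  qed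
  show ?thesis using *[of "translate n x" "- n"] *[of x n] by auto
qed

definition window :: "(int \<Rightarrow> 'a) \<Rightarrow> int \<Rightarrow> nat \<Rightarrow> 'a list" where
  "window x a n = map (\<lambda>k. x (a + int k)) [0..<n]"

lemma length_window [simp]: "length (window x a n) = n"
  by (simp add: window_def)

lemma nth_window [simp]: "k < n \<Longrightarrow> window x a n ! k = x (a + int k)"
  by (simp add: window_def)

lemma occurs_window: "occurs (window x a n) x"
  unfolding occurs_def by (rule exI[of _ a]) simp

definition splice_at :: "int \<Rightarrow> (int \<Rightarrow> 'a) \<Rightarrow> (int \<Rightarrow> 'a) \<Rightarrow> int \<Rightarrow> 'a" where
  "splice_at i x y = (\<lambda>j. if j < i then x j else y j)"

text \<open>A subshift described by sequential closedness and two-sided invariance. In this form it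
  also covers auxiliary sets of limit points, such as \<open>S\<close> in
  \<open>period_transfer\<close>.\<close>

locale invariant_set =
  fixes X :: "(int \<Rightarrow> 'a::finite) set"
  assumes translate_in: "x \<in> X \<Longrightarrow> translate n x \<in> X"
    and limit_in: "converges u x \<Longrightarrow> (\<And>n. u n \<in> X) \<Longrightarrow> x \<in> X"
begin

lemma nonperiodic_translate_in:
  "x \<in> nonperiodic_part X \<Longrightarrow> translate n x \<in> nonperiodic_part X"
  by (simp add: nonperiodic_part_def translate_in)

end

text \<open>The form in which finite type is used: with no forbidden word longer than
  \<open>M\<close>, a word straddling the join of two points would already occur in one of
  them.\<close>

locale spliceable_shift = invariant_set +
  fixes M :: nat
  assumes splice_in: "x \<in> X \<Longrightarrow> y \<in> X \<Longrightarrow> (\<And>j. i \<le> j \<Longrightarrow> j < i + int M \<Longrightarrow> x j = y j)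
    \<Longrightarrow> splice_at i x y \<in> X"

lemma sft_spliceable:
  assumes "subshift_of_finite_type X"
  obtains M where "spliceable_shift X M"
proof -
  obtain F where F: "finite F" "X = avoiding F"
    using assms by (auto simp: subshift_of_finite_type_def)
  \<comment> \<open>The inserted 0 makes the maximum meaningful when no word is forbidden.\<close>
  define M where "M = Max (insert 0 (length ` F))"
  have M: "length u \<le> M" if "u \<in> F" for u
    using that F(1) by (simp add: M_def)
  have "spliceable_shift X M"
  proof
    show "translate n x \<in> X" if "x \<in> X" for x n
      using that by (simp add: F avoiding_def)
    show "x \<in> X" if u: "converges u x" "\<And>n. u n \<in> X" for u x
    proof -
      have "\<not> occurs w x" if "w \<in> F" for w
      proof
        assume "occurs w x"
        then obtain i where i: "\<forall>k < length w. x (i + int k) = w ! k"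
          unfolding occurs_def by blast
        obtain n where n: "\<forall>j\<in>{i..i + int (length w)}. u n j = x j"
          using eventually_happens'[OF sequentially_bot converges_window[OF u(1)]] by blast
        then have "\<forall>k < length w. u n (i + int k) = w ! k" using i by simp
        then have "occurs w (u n)" unfolding occurs_def by blast
        then show False using u(2)[of n] \<open>w \<in> F\<close> by (simp add: F avoiding_def)
      qed
      then show ?thesis by (simp add: F avoiding_def)
    qed
    show "splice_at i x y \<in> X"
      if x: "x \<in> X" and y: "y \<in> X" and eq: "\<And>j. i \<le> j \<Longrightarrow> j < i + int M \<Longrightarrow> x j = y j" for x y i
    proof -
      have "\<not> occurs w (splice_at i x y)" if "w \<in> F" for w
      proof
        assume "occurs w (splice_at i x y)"
        then obtain a where a: "\<forall>k < length w. splice_at i x y (a + int k) = w ! k"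
          unfolding occurs_def by blast
        have len: "length w \<le> M" using M that .
        show False
        \<comment> \<open>A word starting left of the join ends before the overlap does, so it lies
          in \<open>x\<close>; a word starting at the join or later lies in
          \<open>y\<close>.\<close>
        proof (cases "a < i")
          case True
          have "x (a + int k) = w ! k" if "k < length w" for k
            using a that eq[of "a + int k"] True len by (auto simp: splice_at_def split: if_splits)
          then have "occurs w x" unfolding occurs_def by blast
          then show False using x \<open>w \<in> F\<close> by (simp add: F avoiding_def)
        next
          case False
          then have "\<forall>k < length w. y (a + int k) = w ! k"
            using a by (auto simp: splice_at_def split: if_splits)
          then have "occurs w y" unfolding occurs_def by blast
          then show False using y \<open>w \<in> F\<close> by (simp add: F avoiding_def)
        qed
      qed
      then show ?thesis by (simp add: F avoiding_def)
    qed
  qed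
  then show thesis by (rule that)
qed

section \<open>Nonperiodic points asymptotic to periodic points\<close>

lemma infinite_avoids_periodic:
  assumes "infinite X" "periodic p"
  obtains x n where "x \<in> X" "\<And>i. \<exists>j\<in>{- int n..int n}. x j \<noteq> p (j + i)"
proof -
  obtain k where k: "k > 0" "\<And>i. p (i + k) = p i"
    using assms(2) unfolding periodic_iff by blast
  \<comment> \<open>The orbit of \<open>p\<close> is finite, so the infinite set \<open>X\<close>
    has a point \<open>x\<close> outside it. One witness per residue modulo \<open>k\<close>
    distinguishes \<open>x\<close> from the whole orbit, and \<open>n\<close> bounds these finitely
    many witnesses.\<close>
  have "finite ((\<lambda>i. translate i p) ` {0..<k})" by simp
  then obtain x where x: "x \<in> X" "x \<notin> (\<lambda>i. translate i p) ` {0..<k}"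
    using assms(1) by (meson finite_subset subsetI)
  have "\<forall>i\<in>{0..<k}. \<exists>j. x j \<noteq> p (j + i)"
  proof
    fix i assume i: "i \<in> {0..<k}"
    then have "x \<noteq> translate i p" using x(2) by blast
    then show "\<exists>j. x j \<noteq> p (j + i)" by (auto simp: fun_eq_iff)
  qed
  then obtain J where J: "\<And>i. i \<in> {0..<k} \<Longrightarrow> x (J i) \<noteq> p (J i + i)" by metis
  define n where "n = Max ((\<lambda>i. nat \<bar>J i\<bar>) ` {0..<k})"
  show thesis
  proof
    show "x \<in> X" by fact
    fix i
    have i: "i mod k \<in> {0..<k}" using k(1) by simp
    have "p (J (i mod k) + i mod k + (i div k) * k) = p (J (i mod k) + i mod k)"
      using k(2) by (rule period_mult)
    also have "J (i mod k) + i mod k + (i div k) * k = J (i mod k) + i" by simp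
    finally have "x (J (i mod k)) \<noteq> p (J (i mod k) + i)" using J[OF i] by simp
    moreover have "nat \<bar>J (i mod k)\<bar> \<le> n" unfolding n_def using i by (intro Max_ge) auto
    then have "J (i mod k) \<in> {- int n..int n}" by auto
    ultimately show "\<exists>j\<in>{- int n..int n}. x j \<noteq> p (j + i)" by blast
  qed
qed

text \<open>Transitivity of words, restated with positions: the window of \<open>x\<close> stays in
  place, and the window of \<open>y\<close> is moved from \<open>a'\<close> to \<open>c\<close>, to
  the right of it.\<close>

lemma transitive_connect:
  assumes tr: "transitive_shift X" and "invariant_set X" and "x \<in> X" "y \<in> X"
  obtains z c where "z \<in> X" "c \<ge> b" "\<And>j. a \<le> j \<Longrightarrow> j < b \<Longrightarrow> z j = x j"
    "\<And>j. a' \<le> j \<Longrightarrow> j < b' \<Longrightarrow> z (j - a' + c) = y j"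
proof -
  interpret invariant_set X by fact
  let ?u = "window x a (nat (b - a))" and ?v = "window y a' (nat (b' - a'))"
  have "occurs_in ?u X" "occurs_in ?v X"
    using assms occurs_window unfolding occurs_in_def by blast+
  then obtain w where "occurs_in (?u @ w @ ?v) X"
    using tr unfolding transitive_shift_def by blast
  then obtain z0 i where z0: "z0 \<in> X"
    and i: "\<And>k. k < length (?u @ w @ ?v) \<Longrightarrow> z0 (i + int k) = (?u @ w @ ?v) ! k"
    unfolding occurs_in_def occurs_def by blast
  show thesis
  proof
    show "translate (i - a) z0 \<in> X" using z0 by (rule translate_in)
    show "a + int (nat (b - a) + length w) \<ge> b" by simp
    show "translate (i - a) z0 j = x j" if "a \<le> j" "j < b" for j
      using i[of "nat (j - a)"] that by (simp add: nth_append algebra_simps)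
    show "translate (i - a) z0 (j - a' + (a + int (nat (b - a) + length w))) = y j"
      if "a' \<le> j" "j < b'" for j
    proof -
      have eq: "j - a' + (a + int (nat (b - a) + length w)) + (i - a) =
          i + int (nat (b - a) + length w + nat (j - a'))" using that by simp
      have "z0 (i + int (nat (b - a) + length w + nat (j - a'))) = y j"
        using that by (subst i) (auto simp: nth_append nat_less_iff)
      then show ?thesis unfolding translate_apply eq .
    qed
  qed
qed

text \<open>Transitivity and infinitude enter the extension argument through these two conditions.
  Points of both kinds are spliced together and serve to read off the image of
  \<open>p\<close>.\<close>

locale homoclinic_shift = spliceable_shift +
  assumes left_asymptotic:
      "p \<in> X \<Longrightarrow> periodic p \<Longrightarrow> \<exists>x\<in>nonperiodic_part X. \<forall>j<0. x j = p j"
    and right_asymptotic: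
      "p \<in> X \<Longrightarrow> periodic p \<Longrightarrow> \<exists>x\<in>nonperiodic_part X. \<forall>j\<ge>0. x j = p j"

text \<open>A half-line of \<open>p\<close> is joined to a word that does not occur in
  \<open>p\<close>. If the result were periodic, its tail would force it to equal \<open>p\<close>,
  contradicting that word.\<close>

lemma transitive_homoclinic:
  assumes "spliceable_shift X M" "transitive_shift X" "infinite X"
  shows "homoclinic_shift X M"
proof -
  interpret spliceable_shift X M by fact
  have inv: "invariant_set X" by unfold_locales
  show ?thesis
  proof
    fix p assume p: "p \<in> X" "periodic p"
    obtain x n where x: "x \<in> X" and avoid: "\<And>i. \<exists>j\<in>{- int n..int n}. x j \<noteq> p (j + i)"
      using infinite_avoids_periodic[OF assms(3) p(2)] by metis
    show "\<exists>x\<in>nonperiodic_part X. \<forall>j<0. x j = p j"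
    proof -
      \<comment> \<open>The first window consists of \<open>M\<close> symbols of \<open>p\<close>
        and serves as the overlap for splicing; the second is the window of \<open>x\<close> that
        avoids the orbit of \<open>p\<close>.\<close>
      obtain z c where z: "z \<in> X" "c \<ge> 0" "\<And>j. - int M \<le> j \<Longrightarrow> j < 0 \<Longrightarrow> z j = p j"
        "\<And>j. - int n \<le> j \<Longrightarrow> j < int n + 1 \<Longrightarrow> z (j - - int n + c) = x j"
        using transitive_connect[OF assms(2) inv p(1) x] by metis
      let ?y = "splice_at (- int M) p z"
      have y: "?y \<in> X" using z by (intro splice_in p) auto
      have left: "?y j = p j" if "j < 0" for j using that z(3) by (simp add: splice_at_def)
      have "\<not> periodic ?y"
      proof
        assume "periodic ?y"
        then have "?y = p" using periodic_eq_left p(2) left by blast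
        moreover obtain j where j: "j \<in> {- int n..int n}" "x j \<noteq> p (j + (int n + c))"
          using avoid by blast
        moreover have "?y (j + (int n + c)) = x j"
          using z(4)[of j] z(2) j(1) by (simp add: splice_at_def algebra_simps)
        ultimately show False by metis
      qed
      then show ?thesis using y left by (auto simp: nonperiodic_part_def)
    qed
    show "\<exists>x\<in>nonperiodic_part X. \<forall>j\<ge>0. x j = p j"
    proof -
      \<comment> \<open>The bound on \<open>c\<close> keeps the avoiding window left of the splice
        after the translation by \<open>c\<close>.\<close>
      obtain z c where z: "z \<in> X" "c \<ge> int n + 1"
        "\<And>j. - int n \<le> j \<Longrightarrow> j < int n + 1 \<Longrightarrow> z j = x j"
        "\<And>j. 0 \<le> j \<Longrightarrow> j < int M \<Longrightarrow> z (j - 0 + c) = p j"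
        using transitive_connect[OF assms(2) inv x p(1)] by metis
      let ?y = "splice_at 0 (translate c z) p"
      have y: "?y \<in> X" using z by (intro splice_in p translate_in) auto
      have right: "?y j = p j" if "j \<ge> 0" for j using that by (simp add: splice_at_def)
      have "\<not> periodic ?y"
      proof
        assume "periodic ?y"
        then have "?y = p" using periodic_eq_right p(2) right by blast
        moreover obtain j where j: "j \<in> {- int n..int n}" "x j \<noteq> p (j + - c)"
          using avoid by blast
        moreover have "?y (j + - c) = x j"
          using z(3)[of j] z(2) j(1) by (simp add: splice_at_def)
        ultimately show False by metis
      qed
      then show ?thesis using y right by (auto simp: nonperiodic_part_def)
    qed
  qed
qed

context homoclinic_shift
begin

text \<open>For periodic \<open>x\<close>, a left asymptotic point is moved to the right by growing
  multiples of the period, so that its tail fills any given window in the right phase.\<close>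

lemma nonperiodic_dense:
  assumes "x \<in> X"
  obtains u where "converges u x" "\<And>n. u n \<in> nonperiodic_part X"
proof (cases "periodic x")
  case False
  then show ?thesis using assms that[of "\<lambda>_. x"] by (simp add: converges_def nonperiodic_part_def)
next
  case True
  obtain k where k: "k > 0" "\<And>i. x (i + k) = x i" using True unfolding periodic_iff by blast
  obtain y where y: "y \<in> nonperiodic_part X" "\<forall>j<0. y j = x j"
    using left_asymptotic assms True by blast
  show ?thesis
  proof
    show "translate (- (int n + 1) * k) y \<in> nonperiodic_part X" for n
      using y(1) by (rule nonperiodic_translate_in)
    show "converges (\<lambda>n. translate (- (int n + 1) * k) y) x"
    proof (rule convergesI_window)
      fix n i assume i: "i \<in> {- int n..int n}"
      have "int n + 1 \<le> (int n + 1) * k" using k(1) by simp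
      then have "i + - (int n + 1) * k < 0"
        using i unfolding mult_minus_left atLeastAtMost_iff by linarith
      then show "translate (- (int n + 1) * k) y i = x i"
        using y(2) period_mult[of x k i "- (int n + 1)"] k(2) by simp
    qed
  qed
qed

end


section \<open>Sets of periodic points\<close>

text \<open>A closed invariant set consisting of periodic points is finite, because a bounded window
  determines each of its points.\<close>

lemma (in invariant_set) common_period_of_periodic_set:
  assumes per: "\<And>x. x \<in> X \<Longrightarrow> periodic x"
  obtains K where "K > 0" "\<And>x i. x \<in> X \<Longrightarrow> x (i + K) = x i"
proof -
  \<comment> \<open>By compactness finitely many symbols determine the one to their left: limits of
    counterexamples would agree from 0 on, hence coincide by periodicity, and yet differ at
    -1.\<close>
  have "\<exists>n. \<forall>x\<in>X. \<forall>y\<in>X. (\<forall>j\<in>{0..int n}. x j = y j) \<longrightarrow> x (-1) = y (-1)"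
  proof (rule ccontr)
    assume "\<not> ?thesis"
    then have "\<forall>n. \<exists>x y. x \<in> X \<and> y \<in> X \<and> (\<forall>j\<in>{0..int n}. x j = y j) \<and> x (-1) \<noteq> y (-1)" by blast
    then obtain x y where "\<And>n. x n \<in> X \<and> y n \<in> X \<and> (\<forall>j\<in>{0..int n}. x n j = y n j) \<and> x n (-1) \<noteq> y n (-1)"
      by metis
    then have xy: "\<And>n. x n \<in> X" "\<And>n. y n \<in> X" "\<And>n j. 0 \<le> j \<Longrightarrow> j \<le> int n \<Longrightarrow> x n j = y n j"
      "\<And>n. x n (-1) \<noteq> y n (-1)"
      by auto
    obtain r x' where r: "strict_mono r" "converges (x \<circ> r) x'" by (rule convergent_subsequence)
    obtain t y' where t: "strict_mono t" "converges ((y \<circ> r) \<circ> t) y'" by (rule convergent_subsequence)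
    have x': "converges ((x \<circ> r) \<circ> t) x'" using r(2) t(1) by (rule converges_subseq)
    have in_X: "x' \<in> X" "y' \<in> X"
      by (rule limit_in[OF x'], simp add: xy) (rule limit_in[OF t(2)], simp add: xy)
    have "x' j = y' j" if "j \<ge> 0" for j
    proof -
      have "\<forall>\<^sub>F n in sequentially. x (r (t n)) j = x' j \<and> y (r (t n)) j = y' j \<and> n \<ge> nat j"
        using x' t(2) by (intro eventually_conj eventually_ge_at_top) (auto simp: converges_def)
      then obtain n where n: "x (r (t n)) j = x' j" "y (r (t n)) j = y' j" "n \<ge> nat j"
        using eventually_happens'[OF sequentially_bot] by blast
      have "n \<le> r (t n)" using seq_suble[OF strict_mono_o[OF r(1) t(1)], of n] by simp
      then show ?thesis using n xy(3)[of j "r (t n)"] that by simp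
    qed
    then have "x' = y'" using periodic_eq_right per in_X by blast
    moreover have "\<forall>\<^sub>F n in sequentially. x (r (t n)) (-1) = x' (-1) \<and> y (r (t n)) (-1) = y' (-1)"
      using x' t(2) by (intro eventually_conj) (auto simp: converges_def)
    then obtain n where "x (r (t n)) (-1) = x' (-1)" "y (r (t n)) (-1) = y' (-1)"
      using eventually_happens'[OF sequentially_bot] by blast
    ultimately show False using xy(4)[of "r (t n)"] by simp
  qed
  then obtain n where n: "\<And>x y. x \<in> X \<Longrightarrow> y \<in> X \<Longrightarrow> \<forall>j\<in>{0..int n}. x j = y j \<Longrightarrow> x (-1) = y (-1)"
    by blast
  \<comment> \<open>Repeating this on translates extends agreement to a left half-line, where
    periodicity takes over.\<close>
  have determined: "x = y" if xy: "x \<in> X" "y \<in> X" "\<forall>j\<in>{0..int n}. x j = y j" for x y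
  proof (rule periodic_eq_left[where a = "int n"])
    have "\<forall>j\<in>{- int t..int n}. x j = y j" for t
    proof (induction t)
      case (Suc t)
      have "translate (- int t) x (-1) = translate (- int t) y (-1)"
        using Suc xy by (intro n translate_in) auto
      then have new: "x (-1 - int t) = y (-1 - int t)" by simp
      have "x j = y j" if "j \<in> {- int (Suc t)..int n}" for j
      proof (cases "j = -1 - int t")
        case False
        then show ?thesis using Suc that by auto
      qed (use new in simp)
      then show ?case by blast
    qed (use xy in simp)
    then show "x j = y j" if "j < int n" for j
      using that by (metis abs_ge_minus_self atLeastAtMost_iff minus_le_iff less_imp_le nat_0_le abs_ge_zero)
  qed (use xy per in auto)
  have "inj_on (\<lambda>x. window x 0 (Suc n)) X"
  proof (rule inj_onI)
    fix x y assume xy: "x \<in> X" "y \<in> X" "window x 0 (Suc n) = window y 0 (Suc n)"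
    have "x j = y j" if "j \<in> {0..int n}" for j
    proof -
      have "nat j < Suc n" using that by auto
      then have "x (0 + int (nat j)) = y (0 + int (nat j))" using nth_window xy(3) by metis
      then show ?thesis using that by simp
    qed
    then show "x = y" using determined xy by blast
  qed
  moreover have "(\<lambda>x. window x 0 (Suc n)) ` X \<subseteq> {xs. set xs \<subseteq> UNIV \<and> length xs = Suc n}" by auto
  then have "finite ((\<lambda>x. window x 0 (Suc n)) ` X)"
    using finite_lists_length_eq[of "UNIV :: 'a set" "Suc n"] finite_subset finite by blast
  ultimately have fin: "finite X" using finite_imageD by blast
  have "\<forall>x\<in>X. \<exists>k>0. \<forall>i. x (i + k) = x i" using per periodic_iff by blast
  then obtain k where k: "\<And>x. x \<in> X \<Longrightarrow> k x > 0" "\<And>x i. x \<in> X \<Longrightarrow> x (i + k x) = x i" by metis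
  show thesis
  proof
    \<comment> \<open>The product of the finitely many chosen periods is a common multiple of
      them.\<close>
    show "prod k X > 0" using k(1) by (rule prod_pos)
    show "x (i + prod k X) = x i" if x: "x \<in> X" for x i
    proof -
      have "k x dvd prod k X" using fin x by (rule dvd_prodI)
      then obtain m where m: "prod k X = m * k x" by (metis dvd_def mult.commute)
      show ?thesis unfolding m by (rule period_mult) (rule k(2)[OF x])
    qed
  qed
qed

text \<open>Periodicity on a finite stretch only. The hypothesis compares \<open>l\<close> with
  \<open>l + K\<close> for \<open>l\<close> up to \<open>b\<close>, so the stretch itself reaches
  \<open>b + K\<close>.\<close>

lemma eq_along_period:
  fixes y :: "int \<Rightarrow> 'a"
  assumes step: "\<And>l. a \<le> l \<Longrightarrow> l \<le> b \<Longrightarrow> y (l + K) = y l" and "K > 0"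
    and i: "a \<le> i" "i \<le> b + K" and j: "a \<le> j" "j \<le> b + K" and "K dvd i - j"
  shows "y i = y j"
proof -
  have *: "a \<le> i \<Longrightarrow> i + int n * K \<le> b + K \<Longrightarrow> y (i + int n * K) = y i" for n i
  proof (induction n)
    case (Suc n)
    have "i + int n * K + K \<le> b + K" using Suc.prems by (simp add: algebra_simps)
    moreover have "0 \<le> int n * K" using \<open>K > 0\<close> by simp
    ultimately have "y (i + int n * K + K) = y (i + int n * K)" "i + int n * K \<le> b + K"
      using Suc.prems(1) \<open>K > 0\<close> step[of "i + int n * K"] by linarith+
    then show ?case using Suc by (simp add: algebra_simps)
  qed simp
  obtain c where c: "i - j = K * c" using assms by (auto simp: dvd_def)
  show ?thesis
  proof (cases "c \<ge> 0")
    case True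
    then have "i = j + int (nat c) * K" using c by (simp add: algebra_simps)
    then show ?thesis using * i j by metis
  next
    case False
    then have "j = i + int (nat (- c)) * K" using c by (simp add: algebra_simps)
    then show ?thesis using * i j by metis
  qed
qed


section \<open>Extension to the periodic points\<close>

text \<open>Continuity is stated sequentially, with limits in the nonperiodic parts. The locale is
  instantiated twice in the end, for \<open>\<phi>'\<close> and for its inverse.\<close>

locale nonperiodic_conjugacy = X: homoclinic_shift X M + Y: invariant_set Y
  for X :: "(int \<Rightarrow> 'a::finite) set" and M and Y :: "(int \<Rightarrow> 'b::finite) set" +
  fixes f :: "(int \<Rightarrow> 'a) \<Rightarrow> (int \<Rightarrow> 'b)" and g :: "(int \<Rightarrow> 'b) \<Rightarrow> (int \<Rightarrow> 'a)"
  assumes f_in: "x \<in> nonperiodic_part X \<Longrightarrow> f x \<in> nonperiodic_part Y"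
    and g_in: "y \<in> nonperiodic_part Y \<Longrightarrow> g y \<in> nonperiodic_part X"
    and g_f: "x \<in> nonperiodic_part X \<Longrightarrow> g (f x) = x"
    and f_limit: "converges u x \<Longrightarrow> (\<And>n. u n \<in> nonperiodic_part X) \<Longrightarrow> x \<in> nonperiodic_part X
      \<Longrightarrow> converges (f \<circ> u) (f x)"
    and g_limit: "converges v y \<Longrightarrow> (\<And>n. v n \<in> nonperiodic_part Y) \<Longrightarrow> y \<in> nonperiodic_part Y
      \<Longrightarrow> converges (g \<circ> v) (g y)"
    and f_translate: "x \<in> nonperiodic_part X \<Longrightarrow> f (translate n x) = translate n (f x)"
begin

text \<open>If \<open>q\<close> were nonperiodic, continuity of \<open>g\<close> there would make
  \<open>u\<close> converge to \<open>g q\<close>, a nonperiodic point, instead of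
  \<open>p\<close>.\<close>

lemma cluster_value_periodic:
  assumes u: "converges u p" "\<And>n. u n \<in> nonperiodic_part X" and p: "periodic p"
    and q: "converges (f \<circ> u) q"
  shows "periodic q"
proof (rule ccontr)
  assume np: "\<not> periodic q"
  have fu: "(f \<circ> u) n \<in> nonperiodic_part Y" for n using u(2) f_in by simp
  have "q \<in> Y" using q by (rule Y.limit_in) (use fu in \<open>auto simp: nonperiodic_part_def\<close>)
  then have q': "q \<in> nonperiodic_part Y" using np by (simp add: nonperiodic_part_def)
  have "converges (g \<circ> (f \<circ> u)) (g q)" by (rule g_limit[OF q fu q'])
  then have "converges u (g q)" using g_f u(2) by (simp add: o_def)
  then have "p = g q" using u(1) converges_unique by blast
  then show False using g_in[OF q'] p by (simp add: nonperiodic_part_def)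
qed

text \<open>Compactness makes the preceding lemma uniform: local period \<open>K0\<close> of
  \<open>x\<close>, seen within distance \<open>m\<close>, forces local period \<open>K\<close> of
  \<open>f x\<close>, with \<open>m\<close> and \<open>K\<close> independent of
  \<open>x\<close>.\<close>

lemma period_transfer:
  assumes "K0 > 0"
  obtains K m where "K > 0" "K0 dvd K" "m \<ge> 0"
    "\<And>x i. x \<in> nonperiodic_part X \<Longrightarrow> (\<And>j. i - m \<le> j \<Longrightarrow> j \<le> i + m \<Longrightarrow> x (j + K0) = x j)
      \<Longrightarrow> f x (i + K) = f x i"
proof -
  \<comment> \<open>The limits of images of points that have period \<open>K0\<close> on growing
    windows. Limits of the points themselves have period \<open>K0\<close>, so
    \<open>cluster_value_periodic\<close> makes every element of \<open>S\<close> periodic.\<close>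
  define S where "S = {q. \<forall>n. \<exists>x\<in>nonperiodic_part X.
    \<forall>j\<in>{- int n..int n}. x (j + K0) = x j \<and> f x j = q j}"
  interpret S: invariant_set S
  proof
    fix q t assume q: "q \<in> S"
    show "translate t q \<in> S"
      unfolding S_def
    proof (intro CollectI allI)
      fix n
      obtain x where x: "x \<in> nonperiodic_part X"
        "\<forall>j\<in>{- int (n + nat \<bar>t\<bar>)..int (n + nat \<bar>t\<bar>)}. x (j + K0) = x j \<and> f x j = q j"
        using q unfolding S_def by blast
      have "x (j + K0 + t) = x (j + t) \<and> f x (j + t) = q (j + t)" if "j \<in> {- int n..int n}" for j
      proof -
        have "j + t \<in> {- int (n + nat \<bar>t\<bar>)..int (n + nat \<bar>t\<bar>)}" using that by auto
        then have "x (j + t + K0) = x (j + t) \<and> f x (j + t) = q (j + t)" using x(2) by blast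
        then show ?thesis by (simp add: algebra_simps)
      qed
      then show "\<exists>x\<in>nonperiodic_part X. \<forall>j\<in>{- int n..int n}. x (j + K0) = x j \<and> f x j = translate t q j"
        using X.nonperiodic_translate_in[OF x(1), of t] f_translate[OF x(1), of t]
        by (intro bexI[of _ "translate t x"]) auto
    qed
  next
    fix u q assume u: "converges u q" "\<And>n. u n \<in> S"
    show "q \<in> S"
      unfolding S_def
    proof (intro CollectI allI)
      fix n
      obtain k where k: "\<forall>j\<in>{- int n..int n}. u k j = q j"
        using eventually_happens'[OF sequentially_bot converges_window[OF u(1)]] by blast
      obtain x where "x \<in> nonperiodic_part X" "\<forall>j\<in>{- int n..int n}. x (j + K0) = x j \<and> f x j = u k j"
        using u(2)[of k] unfolding S_def by blast
      then show "\<exists>x\<in>nonperiodic_part X. \<forall>j\<in>{- int n..int n}. x (j + K0) = x j \<and> f x j = q j"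
        using k by auto
    qed
  qed
  have "periodic q" if "q \<in> S" for q
  proof -
    have "\<forall>n. \<exists>x. x \<in> nonperiodic_part X \<and> (\<forall>j\<in>{- int n..int n}. x (j + K0) = x j \<and> f x j = q j)"
      using that unfolding S_def by blast
    then obtain x where x: "\<And>n. x n \<in> nonperiodic_part X"
      "\<And>n j. j \<in> {- int n..int n} \<Longrightarrow> x n (j + K0) = x n j \<and> f (x n) j = q j" by metis
    obtain r p where r: "strict_mono r" "converges (x \<circ> r) p" by (rule convergent_subsequence)
    have "p (j + K0) = p j" for j
    proof -
      have "\<forall>\<^sub>F n in sequentially. x (r n) (j + K0) = p (j + K0) \<and> x (r n) j = p j \<and> n \<ge> nat \<bar>j\<bar>"
        using r(2) by (intro eventually_conj eventually_ge_at_top) (auto simp: converges_def)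
      then obtain n where n: "x (r n) (j + K0) = p (j + K0)" "x (r n) j = p j" "n \<ge> nat \<bar>j\<bar>"
        using eventually_happens'[OF sequentially_bot] by blast
      have "j \<in> {- int (r n)..int (r n)}" using n(3) seq_suble[OF r(1), of n] by auto
      then show ?thesis using x(2) n(1,2) by metis
    qed
    then have "periodic p" using assms unfolding periodic_iff by blast
    moreover have "converges (f \<circ> x) q" by (rule convergesI_window) (use x(2) in simp)
    then have "converges (f \<circ> (x \<circ> r)) q" using converges_subseq[OF _ r(1)] by (metis comp_assoc)
    moreover have "(x \<circ> r) n \<in> nonperiodic_part X" for n using x(1) by simp
    ultimately show ?thesis using cluster_value_periodic[OF r(2)] by blast
  qed
  then obtain K1 where K1: "K1 > 0" "\<And>q i. q \<in> S \<Longrightarrow> q (i + K1) = q i"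
    using S.common_period_of_periodic_set by blast
  \<comment> \<open>The factor \<open>K0\<close> ensures that moving by \<open>K\<close> keeps both
    a \<open>K0\<close>-periodic point and its image in phase.\<close>
  define K where "K = K0 * K1"
  have K: "q (i + K) = q i" if "q \<in> S" for q i
    unfolding K_def using K1(2)[OF that] by (rule period_mult)
  \<comment> \<open>Images of counterexamples for growing \<open>m\<close> would accumulate at an
    element of \<open>S\<close> that violates the period \<open>K\<close>.\<close>
  have "\<exists>m. \<forall>x\<in>nonperiodic_part X. (\<forall>j\<in>{- int m..int m}. x (j + K0) = x j) \<longrightarrow> f x K = f x 0"
  proof (rule ccontr)
    assume "\<not> ?thesis"
    then have "\<forall>m. \<exists>x. x \<in> nonperiodic_part X \<and> (\<forall>j\<in>{- int m..int m}. x (j + K0) = x j) \<and> f x K \<noteq> f x 0"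
      by blast
    then obtain x where x: "\<And>n. x n \<in> nonperiodic_part X"
      "\<And>n j. j \<in> {- int n..int n} \<Longrightarrow> x n (j + K0) = x n j" "\<And>n. f (x n) K \<noteq> f (x n) 0"
      by metis
    obtain r q where r: "strict_mono r" "converges ((f \<circ> x) \<circ> r) q" by (rule convergent_subsequence)
    have "q \<in> S"
      unfolding S_def
    proof (intro CollectI allI)
      fix n
      have "\<forall>\<^sub>F k in sequentially. (\<forall>j\<in>{- int n..int n}. (f \<circ> x \<circ> r) k j = q j) \<and> k \<ge> n"
        by (intro eventually_conj eventually_ge_at_top converges_window r)
      then obtain k where k: "\<forall>j\<in>{- int n..int n}. (f \<circ> x \<circ> r) k j = q j" "k \<ge> n"
        using eventually_happens'[OF sequentially_bot] by blast
      have "k \<le> r k" using r(1) by (rule seq_suble)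
      then show "\<exists>x\<in>nonperiodic_part X. \<forall>j\<in>{- int n..int n}. x (j + K0) = x j \<and> f x j = q j"
        using k x(2)[where n = "r k"] x(1) by (intro bexI[of _ "x (r k)"]) auto
    qed
    have "\<forall>\<^sub>F k in sequentially. (f \<circ> x \<circ> r) k K = q K \<and> (f \<circ> x \<circ> r) k 0 = q 0"
      using r(2) by (intro eventually_conj) (auto simp: converges_def)
    then obtain k where "(f \<circ> x \<circ> r) k K = q K \<and> (f \<circ> x \<circ> r) k 0 = q 0"
      using eventually_happens'[OF sequentially_bot] by blast
    then show False using K[OF \<open>q \<in> S\<close>, of 0] x(3)[of "r k"] by simp
  qed
  then obtain m where m: "\<And>x. x \<in> nonperiodic_part X \<Longrightarrow> \<forall>j\<in>{- int m..int m}. x (j + K0) = x j \<Longrightarrow> f x K = f x 0"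
    by blast
  show thesis
  proof
    show "K > 0" "K0 dvd K" using assms K1(1) by (simp_all add: K_def)
    show "int m \<ge> 0" by simp
    fix x i assume x: "x \<in> nonperiodic_part X" "\<And>j. i - int m \<le> j \<Longrightarrow> j \<le> i + int m \<Longrightarrow> x (j + K0) = x j"
    have "\<forall>j\<in>{- int m..int m}. translate i x (j + K0) = translate i x j"
      using x(2)[of "_ + i"] by (auto simp: algebra_simps)
    then have "f (translate i x) K = f (translate i x) 0" by (intro m X.nonperiodic_translate_in x(1))
    then show "f x (i + K) = f x i" using f_translate[OF x(1)] by (simp add: add.commute)
  qed
qed

text \<open>The spliced points look like \<open>x\<close> near 0 and like \<open>y\<close> far to
  the right, with \<open>p\<close> in between. The image of this middle stretch has period
  \<open>K\<close>, so it carries the value of \<open>f x\<close> at \<open>i\<close> over to that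
  of \<open>f y\<close> at \<open>j\<close>.\<close>

lemma asymptotic_images_match:
  assumes K: "K0 > 0" "K > 0" "K0 dvd K" and p: "\<And>i. p (i + K0) = p i"
    and transfer: "\<And>x i. x \<in> nonperiodic_part X \<Longrightarrow> (\<And>j. i - m \<le> j \<Longrightarrow> j \<le> i + m \<Longrightarrow> x (j + K0) = x j)
      \<Longrightarrow> f x (i + K) = f x i"
    and x: "x \<in> nonperiodic_part X" "\<And>j. j \<ge> 0 \<Longrightarrow> x j = p j"
    and y: "y \<in> nonperiodic_part X" "\<And>j. j < 0 \<Longrightarrow> y j = p j"
    and i: "i \<ge> m" and j: "j < - m - K0" and ij: "K dvd i - j"
  shows "f x i = f y j"
proof -
  \<comment> \<open>A multiple of \<open>K\<close> keeps \<open>p\<close> in phase; the summand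
    \<open>int M + 1\<close> leaves room for the overlap between \<open>c n\<close> and
    \<open>2 * c n\<close>, and \<open>int n\<close> makes the visible windows grow.\<close>
  define c where "c n = (int n + int M + 1) * K" for n
  have c_ge: "c n \<ge> int n + int M + 1" for n
    using K(2) mult_left_mono[of 1 K "int n + int M + 1"] by (simp add: c_def)
  have c_mono: "c a \<le> c b" if "a \<le> b" for a b
    using that K(2) by (simp add: c_def mult_right_mono)
  define z where "z n = splice_at (c n) x (translate (- 2 * c n) y)" for n
  have pK: "p (l + t * K) = p l" for l t
  proof -
    obtain d where "K = K0 * d" using K(3) by (auto simp: dvd_def)
    then have eq: "t * K = (t * d) * K0" by (simp only: mult_ac)
    show ?thesis unfolding eq by (rule period_mult) (rule p)
  qed
  have y_p: "y (l - 2 * c n) = p l" if "l < 2 * c n" for l n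
    using y(2)[of "l - 2 * c n"] that pK[of l "- 2 * (int n + int M + 1)"] by (simp add: c_def algebra_simps)
  have z_X: "z n \<in> X" for n
    unfolding z_def
  proof (rule X.splice_in)
    show "x \<in> X" "translate (- 2 * c n) y \<in> X"
      using x(1) y(1) X.translate_in by (auto simp: nonperiodic_part_def)
    fix l assume l: "c n \<le> l" "l < c n + int M"
    then have "l \<ge> 0" "l < 2 * c n" using c_ge[of n] by linarith+
    then show "x l = translate (- 2 * c n) y l" using x(2) y_p by simp
  qed
  have z_p: "z n l = p l" if "0 \<le> l" "l < 2 * c n" for n l
    using that x(2) y_p by (simp add: z_def splice_at_def)
  have z_x: "converges z x"
  proof (rule convergesI_window)
    fix n l assume "l \<in> {- int n..int n}"
    then have "l < c n" using c_ge[of n] by auto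
    then show "z n l = x l" by (simp add: z_def splice_at_def)
  qed
  have z_y: "converges (\<lambda>n. translate (2 * c n) (z n)) y"
  proof (rule convergesI_window)
    fix n l assume "l \<in> {- int n..int n}"
    then have "\<not> l + 2 * c n < c n" using c_ge[of n] by auto
    then show "translate (2 * c n) (z n) l = y l" by (simp add: z_def splice_at_def)
  qed
  \<comment> \<open>If the spliced points were periodic from \<open>N\<close> on, they would all
    equal \<open>z N\<close>, since they share a left half-line; their limit \<open>x\<close> would
    then be periodic.\<close>
  have inf: "infinite {n. \<not> periodic (z n)}"
  proof
    assume "finite {n. \<not> periodic (z n)}"
    then obtain N where "{n. \<not> periodic (z n)} \<subseteq> {..<N}"
      using finite_nat_iff_bounded by blast
    then have N: "periodic (z n)" if "n \<ge> N" for n using that by (auto simp: subset_iff leD)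
    have const: "z n = z N" if "n \<ge> N" for n
    proof (rule periodic_eq_left[where a = "c N"])
      fix l assume "l < c N"
      moreover from this have "l < c n" using c_mono[OF that] by linarith
      ultimately show "z n l = z N l" by (simp add: z_def splice_at_def)
    qed (use N that in auto)
    have "converges z (z N)"
      unfolding converges_def
    proof
      fix l
      have "\<forall>\<^sub>F n in sequentially. n \<ge> N" by (rule eventually_ge_at_top)
      then show "\<forall>\<^sub>F n in sequentially. z n l = z N l"
        by (rule eventually_mono) (use const in metis)
    qed
    then have "x = z N" using z_x converges_unique by blast
    then show False using N[of N] x(1) by (simp add: nonperiodic_part_def)
  qed
  obtain r :: "nat \<Rightarrow> nat" where r: "strict_mono r" "\<forall>n. r n \<in> {n. \<not> periodic (z n)}"
    using infinite_enumerate[OF inf] by blast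
  have zr: "z (r n) \<in> nonperiodic_part X" for n
    using r(2) z_X by (simp add: nonperiodic_part_def)
  have "converges (f \<circ> (z \<circ> r)) (f x)"
    by (rule f_limit[OF converges_subseq[OF z_x r(1)] _ x(1)]) (simp add: zr)
  moreover have "converges (f \<circ> ((\<lambda>n. translate (2 * c n) (z n)) \<circ> r)) (f y)"
    by (rule f_limit[OF converges_subseq[OF z_y r(1)] _ y(1)])
      (simp add: zr X.nonperiodic_translate_in)
  ultimately have "\<forall>\<^sub>F n in sequentially. (f \<circ> (z \<circ> r)) n i = f x i \<and>
      (f \<circ> ((\<lambda>n. translate (2 * c n) (z n)) \<circ> r)) n j = f y j \<and> n \<ge> nat (\<bar>i\<bar> + \<bar>j\<bar> + \<bar>m\<bar> + K0)"
    by (intro eventually_conj eventually_ge_at_top) (auto simp: converges_def)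
  from eventually_happens'[OF sequentially_bot this]
  obtain n where n: "f (z (r n)) i = f x i" "f (translate (2 * c (r n)) (z (r n))) j = f y j"
    "n \<ge> nat (\<bar>i\<bar> + \<bar>j\<bar> + \<bar>m\<bar> + K0)"
    unfolding comp_apply by blast
  let ?c = "c (r n)"
  have "n \<le> r n" using r(1) by (rule seq_suble)
  then have large: "?c \<ge> \<bar>i\<bar> + \<bar>j\<bar> + \<bar>m\<bar> + K0" using n(3) c_ge[of "r n"] by linarith
  have "f (z (r n)) i = f (z (r n)) (j + 2 * ?c)"
  proof (rule eq_along_period[where a = m and b = "2 * ?c - 1 - m - K0" and K = K])
    fix l assume l: "m \<le> l" "l \<le> 2 * ?c - 1 - m - K0"
    show "f (z (r n)) (l + K) = f (z (r n)) l"
    proof (rule transfer[OF zr])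
      fix t assume "l - m \<le> t" "t \<le> l + m"
      then have "z (r n) (t + K0) = p (t + K0)" "z (r n) t = p t"
        using l K(1) by (auto intro!: z_p)
      then show "z (r n) (t + K0) = z (r n) t" using p by simp
    qed
  next
    have "K dvd ?c" by (simp add: c_def)
    then have "K dvd (i - j) - 2 * ?c" using ij by (meson dvd_diff dvd_mult)
    then show "K dvd i - (j + 2 * ?c)" by (simp add: algebra_simps)
  qed (use K i j large in linarith)+
  then show ?thesis using n(1,2) f_translate[OF zr] by simp
qed

text \<open>All right asymptotic points are compared with all left asymptotic ones, so fixing one of
  each kind yields a single sequence \<open>q\<close> for both kinds.\<close>

lemma asymptotic_image:
  assumes K: "K0 > 0" "K > 0" "K0 dvd K" and p: "p \<in> X" "\<And>i. p (i + K0) = p i"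
    and "m \<ge> 0"
    and transfer: "\<And>x i. x \<in> nonperiodic_part X \<Longrightarrow> (\<And>j. i - m \<le> j \<Longrightarrow> j \<le> i + m \<Longrightarrow> x (j + K0) = x j)
      \<Longrightarrow> f x (i + K) = f x i"
  obtains q where "\<And>i. q (i + K) = q i"
    "\<And>x i. x \<in> nonperiodic_part X \<Longrightarrow> (\<And>j. j \<ge> 0 \<Longrightarrow> x j = p j) \<Longrightarrow> i \<ge> m \<Longrightarrow> f x i = q i"
    "\<And>y i. y \<in> nonperiodic_part X \<Longrightarrow> (\<And>j. j < 0 \<Longrightarrow> y j = p j) \<Longrightarrow> i < - m - K0 \<Longrightarrow> f y i = q i"
proof -
  have per: "periodic p" using K(1) p(2) periodic_iff by blast
  obtain x0 where x0: "x0 \<in> nonperiodic_part X" "\<And>j. j \<ge> 0 \<Longrightarrow> x0 j = p j"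
    using X.right_asymptotic[OF p(1) per] by blast
  obtain y0 where y0: "y0 \<in> nonperiodic_part X" "\<And>j. j < 0 \<Longrightarrow> y0 j = p j"
    using X.left_asymptotic[OF p(1) per] by blast
  have match: "f x i = f y j"
    if "x \<in> nonperiodic_part X" "\<And>j. j \<ge> 0 \<Longrightarrow> x j = p j"
      "y \<in> nonperiodic_part X" "\<And>j. j < 0 \<Longrightarrow> y j = p j"
      "i \<ge> m" "j < - m - K0" "K dvd i - j" for x y i j
    by (rule asymptotic_images_match[where p = p and m = m and K = K and ?K0.0 = K0])
      (fact K p(2) transfer that)+
  \<comment> \<open>The argument of \<open>f x0\<close> is a representative of \<open>i\<close>
    modulo \<open>K\<close> that is at least \<open>m\<close>, hence in the range of
    \<open>match\<close>.\<close>
  define q where "q i = f x0 (i mod K + m * K)" for i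
  have m_le: "i mod K + m * K \<ge> m" for i
  proof -
    have "m * K \<ge> m" using \<open>m \<ge> 0\<close> K(2) mult_left_mono[of 1 K m] by simp
    moreover have "i mod K \<ge> 0" using K(2) by simp
    ultimately show ?thesis by linarith
  qed
  have dvd: "K dvd i mod K + m * K - j" if "K dvd i - j" for i j
  proof -
    have "i mod K + m * K - j = (i - j) + K * (m - i div K)"
      by (simp add: algebra_simps minus_div_mult_eq_mod[symmetric])
    then show ?thesis using that by (simp only: dvd_add dvd_triv_left)
  qed
  have left: "f y j = q i" if "y \<in> nonperiodic_part X" "\<And>j. j < 0 \<Longrightarrow> y j = p j" "j < - m - K0"
    "K dvd i - j" for y i j
    unfolding q_def using match[OF x0 that(1,2) m_le that(3) dvd[OF that(4)]] by simp
  show thesis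
  proof
    show "q (i + K) = q i" for i by (simp add: q_def)
    show "f y i = q i" if "y \<in> nonperiodic_part X" "\<And>j. j < 0 \<Longrightarrow> y j = p j" "i < - m - K0" for y i
      using left that by simp
    fix x i assume x: "x \<in> nonperiodic_part X" "\<And>j. j \<ge> 0 \<Longrightarrow> x j = p j" and i: "i \<ge> m"
    \<comment> \<open>Two right asymptotic points are compared through \<open>y0\<close>, at a
      position far to the left and congruent to \<open>i\<close>.\<close>
    define j where "j = i - (\<bar>i\<bar> + m + K0 + 1) * K"
    have "(\<bar>i\<bar> + m + K0 + 1) * K \<ge> (\<bar>i\<bar> + m + K0 + 1)"
      using K \<open>m \<ge> 0\<close> mult_left_mono[of 1 K "\<bar>i\<bar> + m + K0 + 1"] by simp
    then have j: "j < - m - K0" unfolding j_def by linarith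
    have d: "K dvd i - j" by (simp add: j_def)
    have "f x i = f y0 j" using match[OF x y0 i j d] by simp
    then show "f x i = q i" using left[OF y0 j d] by simp
  qed
qed

text \<open>The value \<open>b\<close> is \<open>q 0\<close>. A counterexample follows
  \<open>p\<close> on a long stretch around 0 and leaves it on the right; seen from that exit it is
  close to a left asymptotic point, whose image has tail \<open>q\<close>, and local periodicity
  carries this value back to 0.\<close>

lemma continuous_at_periodic:
  assumes p: "p \<in> X" "periodic p"
  obtains n b where "\<And>x. x \<in> nonperiodic_part X \<Longrightarrow> (\<And>j. j \<in> {- int n..int n} \<Longrightarrow> x j = p j) \<Longrightarrow> f x 0 = b"
proof -
  obtain K0 where K0: "K0 > 0" "\<And>i. p (i + K0) = p i" using p(2) unfolding periodic_iff by blast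
  obtain K m where K: "K > 0" "K0 dvd K" and m: "m \<ge> 0"
    and transfer: "\<And>x i. x \<in> nonperiodic_part X \<Longrightarrow> (\<And>j. i - m \<le> j \<Longrightarrow> j \<le> i + m \<Longrightarrow> x (j + K0) = x j)
      \<Longrightarrow> f x (i + K) = f x i"
    using period_transfer[OF K0(1)] by blast
  obtain q where q: "\<And>i. q (i + K) = q i"
    and right: "\<And>x i. x \<in> nonperiodic_part X \<Longrightarrow> (\<And>j. j \<ge> 0 \<Longrightarrow> x j = p j) \<Longrightarrow> i \<ge> m \<Longrightarrow> f x i = q i"
    and left: "\<And>y i. y \<in> nonperiodic_part X \<Longrightarrow> (\<And>j. j < 0 \<Longrightarrow> y j = p j) \<Longrightarrow> i < - m - K0 \<Longrightarrow> f y i = q i"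
    using asymptotic_image[OF K0(1) K p(1) K0(2) m transfer] by blast
  have pK: "p (l + t * K) = p l" for l t
  proof -
    obtain d where "K = K0 * d" using K(2) by (auto simp: dvd_def)
    then have eq: "t * K = (t * d) * K0" by (simp only: mult_ac)
    show ?thesis unfolding eq by (rule period_mult) (rule K0(2))
  qed
  \<comment> \<open>A margin wide enough for a move by \<open>m * K\<close> and for the image to
    have period \<open>K\<close> around 0.\<close>
  define N where "N = nat (m * K + K0 + m + 1)"
  have mK: "0 \<le> m * K" using m K(1) by simp
  then have N: "int N = m * K + K0 + m + 1" using m K0(1) by (simp add: N_def)
  have "\<exists>n. \<forall>x\<in>nonperiodic_part X. (\<forall>j\<in>{- int n..int n}. x j = p j) \<longrightarrow> f x 0 = q 0"
  proof (rule ccontr)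
    assume "\<not> ?thesis"
    then have "\<forall>n. \<exists>x. x \<in> nonperiodic_part X \<and> (\<forall>j\<in>{- int (n + N)..int (n + N)}. x j = p j) \<and> f x 0 \<noteq> q 0"
      by blast
    then obtain u where u: "\<And>n. u n \<in> nonperiodic_part X"
      "\<And>n j. j \<in> {- int (n + N)..int (n + N)} \<Longrightarrow> u n j = p j" "\<And>n. f (u n) 0 \<noteq> q 0"
      by metis
    \<comment> \<open>Otherwise the translate of \<open>u n\<close> by \<open>- m * K\<close> would
      be right asymptotic to \<open>p\<close>, and its image at \<open>m * K\<close>, which is
      \<open>f (u n) 0\<close>, would be \<open>q 0\<close>.\<close>
    have "\<exists>k::nat. u n (int k) \<noteq> p (int k)" for n
    proof (rule ccontr)
      assume "\<not> ?thesis"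
      then have nonneg: "u n j = p j" if "j \<ge> 0" for j using that by (metis nat_0_le)
      let ?x = "translate (- m * K) (u n)"
      have "?x j = p j" if "j \<ge> 0" for j
      proof -
        have "u n (j - m * K) = p (j - m * K)"
        proof (cases "j - m * K \<ge> 0")
          case False
          then show ?thesis
            using that N K0(1) m mK
            by (intro u(2)) (simp only: atLeastAtMost_iff of_nat_add, linarith)
        qed (rule nonneg)
        then show ?thesis using pK[of j "- m"] by simp
      qed
      moreover have "m \<le> m * K" using m K(1) mult_left_mono[of 1 K m] by simp
      ultimately have "f ?x (m * K) = q (m * K)" by (intro right X.nonperiodic_translate_in u(1))
      also have "\<dots> = q 0" using period_mult[of q K 0 m] q by simp
      finally show False using u(3)[of n] f_translate[OF u(1)] by simp
    qed
    define e where "e n = int (LEAST k. u n (int k) \<noteq> p (int k))" for n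
    have e_neq: "u n (e n) \<noteq> p (e n)" for n
      unfolding e_def using \<open>\<And>n. \<exists>k::nat. u n (int k) \<noteq> p (int k)\<close>[of n] by (rule LeastI_ex)
    have e_nonneg: "e n \<ge> 0" for n by (simp add: e_def)
    have e_ge: "e n > int (n + N)" for n
      using e_neq[of n] u(2)[of "e n" n] e_nonneg[of n] by (cases "e n \<le> int (n + N)") auto
    have u_p: "u n l = p l" if "- int (n + N) \<le> l" "l < e n" for n l
    proof (cases "l \<ge> 0")
      case True
      then have "nat l < (LEAST k. u n (int k) \<noteq> p (int k))" using that by (simp add: e_def)
      then have "\<not> u n (int (nat l)) \<noteq> p (int (nat l))" by (rule not_less_Least)
      then show ?thesis using True by simp
    qed (use u(2) that in auto)
    define s where "s n = e n div K" for n
    have s: "s n * K + e n mod K = e n" "s n * K \<ge> 0" for n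
      using e_nonneg[of n] K(1) by (simp_all add: s_def pos_imp_zdiv_nonneg_iff)
    have e_mod: "0 \<le> e n mod K" "e n mod K < K" for n using K(1) by simp_all
    \<comment> \<open>Translating by a multiple of \<open>K\<close> rather than by \<open>e n\<close> keeps \<open>p\<close> and \<open>q\<close> in phase.\<close>
    define w where "w n = translate (s n * K) (u n)" for n
    have w_X': "w n \<in> nonperiodic_part X" for n
      unfolding w_def by (rule X.nonperiodic_translate_in) (rule u(1))
    have w_p: "w n l = p l" if "- int n \<le> l" "l < 0" for n l
    proof -
      have "u n (l + s n * K) = p (l + s n * K)"
        using that s[of n] e_mod[of n] by (intro u_p) linarith+
      then show ?thesis using pK by (simp add: w_def)
    qed
    have w_neq: "w n (e n mod K) \<noteq> p (e n mod K)" for n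
      using e_neq[of n] s(1)[of n] pK[of "e n mod K" "s n"] by (simp add: w_def add.commute)
    obtain r v where r: "strict_mono r" "converges (w \<circ> r) v" by (rule convergent_subsequence)
    have r_ge: "n \<le> r n" for n using r(1) by (rule seq_suble)
    have v_p: "v l = p l" if "l < 0" for l
    proof -
      have "\<forall>\<^sub>F n in sequentially. (w \<circ> r) n l = v l \<and> n \<ge> nat \<bar>l\<bar>"
        using r(2) by (intro eventually_conj eventually_ge_at_top) (auto simp: converges_def)
      then obtain n where n: "w (r n) l = v l" "n \<ge> nat \<bar>l\<bar>"
        using eventually_happens'[OF sequentially_bot] by (metis (mono_tags, lifting) comp_apply)
      then have "- int (r n) \<le> l" using r_ge[of n] by linarith
      then show ?thesis using w_p[of "r n" l] that n(1) by simp
    qed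
    have "v \<in> X" using r(2) by (rule X.limit_in) (use w_X' in \<open>simp add: nonperiodic_part_def\<close>)
    \<comment> \<open>Every \<open>w n\<close> differs from \<open>p\<close> at some place in
      \<open>{0..<K}\<close>, a finite range, so the limit cannot be \<open>p\<close>, the only
      periodic point with its left tail.\<close>
    moreover have "\<not> periodic v"
    proof
      assume "periodic v"
      then have "v = p" using periodic_eq_left p(2) v_p by blast
      moreover obtain n where "\<forall>l\<in>{0..K}. (w \<circ> r) n l = v l"
        using eventually_happens'[OF sequentially_bot converges_window[OF r(2)]] by blast
      ultimately show False using w_neq[of "r n"] e_mod[of "r n"] by auto
    qed
    ultimately have v: "v \<in> nonperiodic_part X" by (simp add: nonperiodic_part_def)
    \<comment> \<open>A multiple of \<open>K\<close>, so that \<open>q i = q 0\<close>, lying far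
      enough to the left for \<open>left\<close> to apply to \<open>v\<close>.\<close>
    define i where "i = (- m - K0 - 1) * K"
    have "(m + K0 + 1) * K \<ge> m + K0 + 1"
      using K m K0(1) mult_left_mono[of 1 K "m + K0 + 1"] by simp
    then have i: "i < - m - K0" by (simp add: i_def algebra_simps)
    have "f v i = q i" using v v_p i by (rule left)
    also have "\<dots> = q 0" using period_mult[of q K 0 "- m - K0 - 1"] q by (simp add: i_def)
    finally have fv: "f v i = q 0" .
    have "converges (f \<circ> (w \<circ> r)) (f v)" using r(2) _ v by (rule f_limit) (simp add: w_X')
    then have "\<forall>\<^sub>F n in sequentially. (f \<circ> (w \<circ> r)) n i = f v i \<and> n \<ge> nat \<bar>i\<bar>"
      by (intro eventually_conj eventually_ge_at_top) (auto simp: converges_def)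
    then obtain n0 where n0: "f (w (r n0)) i = f v i" "n0 \<ge> nat \<bar>i\<bar>"
      using eventually_happens'[OF sequentially_bot] by (metis (mono_tags, lifting) comp_apply)
    define n where "n = r n0"
    have n: "f (w n) i = q 0" "int n \<ge> \<bar>i\<bar>" using n0 fv r_ge[of n0] by (auto simp: n_def)
    have "f (u n) 0 = f (u n) (i + s n * K)"
    proof (rule eq_along_period[where a = "m - int (n + N)" and b = "e n - 1 - m - K0" and K = K])
      fix l assume l: "m - int (n + N) \<le> l" "l \<le> e n - 1 - m - K0"
      show "f (u n) (l + K) = f (u n) l"
      proof (rule transfer[OF u(1)])
        fix t assume "l - m \<le> t" "t \<le> l + m"
        then have "u n (t + K0) = p (t + K0)" "u n t = p t"
          using l K0(1) by (auto intro!: u_p)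
        then show "u n (t + K0) = u n t" using K0(2) by simp
      qed
    next
      show "K dvd 0 - (i + s n * K)" by (simp add: i_def)
    next
      show "m - int (n + N) \<le> 0" using N mK K0(1) by simp
      show "0 \<le> e n - 1 - m - K0 + K" using N mK K(1) e_ge[of n] by simp
      show "m - int (n + N) \<le> i + s n * K" using N mK K0(1) n(2) s(2)[of n] by simp
      show "i + s n * K \<le> e n - 1 - m - K0 + K" using i K(1) s(1)[of n] e_mod[of n] by linarith
    qed (rule K(1))
    then show False using n(1) u(3)[of n] f_translate[OF u(1)] by (simp add: w_def)
  qed
  then show thesis using that by blast
qed

section \<open>Uniform continuity and the sliding block code\<close>

lemma uniformly_continuous:
  obtains n where "\<And>x y. x \<in> nonperiodic_part X \<Longrightarrow> y \<in> nonperiodic_part X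
    \<Longrightarrow> \<forall>j\<in>{- int n..int n}. x j = y j \<Longrightarrow> f x 0 = f y 0"
proof -
  have "\<exists>n. \<forall>x\<in>nonperiodic_part X. \<forall>y\<in>nonperiodic_part X. (\<forall>j\<in>{- int n..int n}. x j = y j) \<longrightarrow> f x 0 = f y 0"
  proof (rule ccontr)
    assume "\<not> ?thesis"
    then have "\<forall>n. \<exists>x y. x \<in> nonperiodic_part X \<and> y \<in> nonperiodic_part X \<and>
        (\<forall>j\<in>{- int n..int n}. x j = y j) \<and> f x 0 \<noteq> f y 0" by blast
    then obtain x y where xy: "\<And>n. x n \<in> nonperiodic_part X" "\<And>n. y n \<in> nonperiodic_part X"
      "\<And>n j. j \<in> {- int n..int n} \<Longrightarrow> x n j = y n j" "\<And>n. f (x n) 0 \<noteq> f (y n) 0"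
      by metis
    \<comment> \<open>Both sequences of a counterexample accumulate at the same \<open>p\<close>. If
      \<open>p\<close> is periodic, \<open>continuous_at_periodic\<close> applies; otherwise
      \<open>f\<close> itself is continuous there.\<close>
    obtain r p where r: "strict_mono r" "converges (x \<circ> r) p" by (rule convergent_subsequence)
    have r_ge: "n \<le> r n" for n using r(1) by (rule seq_suble)
    have y_p: "converges (y \<circ> r) p"
      unfolding converges_def
    proof
      fix i
      have "\<forall>\<^sub>F n in sequentially. (x \<circ> r) n i = p i \<and> n \<ge> nat \<bar>i\<bar>"
        using r(2) by (intro eventually_conj eventually_ge_at_top) (auto simp: converges_def)
      then show "\<forall>\<^sub>F n in sequentially. (y \<circ> r) n i = p i"
      proof eventually_elim
        case (elim n)
        then have "i \<in> {- int (r n)..int (r n)}" using r_ge[of n] by auto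
        then show ?case using elim xy(3) by (metis comp_apply)
      qed
    qed
    have "p \<in> X" using r(2) by (rule X.limit_in) (use xy(1) in \<open>simp add: nonperiodic_part_def\<close>)
    show False
    proof (cases "periodic p")
      case True
      obtain n b where nb: "\<And>x. x \<in> nonperiodic_part X \<Longrightarrow> (\<And>j. j \<in> {- int n..int n} \<Longrightarrow> x j = p j) \<Longrightarrow> f x 0 = b"
        using continuous_at_periodic[OF \<open>p \<in> X\<close> True] by blast
      have "\<forall>\<^sub>F k in sequentially. (\<forall>j\<in>{- int n..int n}. (x \<circ> r) k j = p j) \<and> (\<forall>j\<in>{- int n..int n}. (y \<circ> r) k j = p j)"
        by (intro eventually_conj converges_window r(2) y_p)
      then obtain k where "\<forall>j\<in>{- int n..int n}. (x \<circ> r) k j = p j" "\<forall>j\<in>{- int n..int n}. (y \<circ> r) k j = p j"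
        using eventually_happens'[OF sequentially_bot] by blast
      then have "f (x (r k)) 0 = b" "f (y (r k)) 0 = b" using nb xy(1,2) by simp_all
      then show False using xy(4)[of "r k"] by simp
    next
      case False
      then have p: "p \<in> nonperiodic_part X" using \<open>p \<in> X\<close> by (simp add: nonperiodic_part_def)
      have "converges (f \<circ> (x \<circ> r)) (f p)" "converges (f \<circ> (y \<circ> r)) (f p)"
        by (rule f_limit[OF r(2) _ p], simp add: xy) (rule f_limit[OF y_p _ p], simp add: xy)
      then have "\<forall>\<^sub>F k in sequentially. (f \<circ> (x \<circ> r)) k 0 = f p 0 \<and> (f \<circ> (y \<circ> r)) k 0 = f p 0"
        by (intro eventually_conj) (auto simp: converges_def)
      then obtain k where "(f \<circ> (x \<circ> r)) k 0 = f p 0 \<and> (f \<circ> (y \<circ> r)) k 0 = f p 0"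
        using eventually_happens'[OF sequentially_bot] by blast
      then show False using xy(4)[of "r k"] by simp
    qed
  qed
  then show thesis using that by blast
qed

lemma sliding_block_extension:
  obtains F n where "\<And>x. x \<in> nonperiodic_part X \<Longrightarrow> F x = f x" "\<And>x. x \<in> X \<Longrightarrow> F x \<in> Y"
    "\<And>x k. F (translate k x) = translate k (F x)"
    "\<And>x y i. \<forall>j\<in>{i - int n..i + int n}. x j = y j \<Longrightarrow> F x i = F y i"
proof -
  obtain n where n: "\<And>x y. x \<in> nonperiodic_part X \<Longrightarrow> y \<in> nonperiodic_part X
    \<Longrightarrow> \<forall>j\<in>{- int n..int n}. x j = y j \<Longrightarrow> f x 0 = f y 0"
    using uniformly_continuous by blast
  define near where "near x i z \<longleftrightarrow> z \<in> nonperiodic_part X \<and> (\<forall>j\<in>{- int n..int n}. z j = x (j + i))" for x i z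
  \<comment> \<open>The local rule reads \<open>f\<close> at any nonperiodic point showing the same
    window; by \<open>n\<close> the choice does not affect the value.\<close>
  define F where "F x i = f (SOME z. near x i z) 0" for x i
  have loc: "F x i = F y i" if "\<forall>j\<in>{i - int n..i + int n}. x j = y j" for x y i
  proof -
    have "x (j + i) = y (j + i)" if "j \<in> {- int n..int n}" for j
      using \<open>\<forall>j\<in>{i - int n..i + int n}. x j = y j\<close> that by simp
    \<comment> \<open>Equal windows give the same predicate, hence the same choice, even where no
      nonperiodic point shows the window. Thus locality and equivariance of \<open>F\<close> hold on
      the whole full shift.\<close>
    then have "near x i = near y i" by (simp add: near_def fun_eq_iff)
    then show ?thesis by (simp add: F_def)
  qed
  have F_f: "F x = f x" if x: "x \<in> nonperiodic_part X" for x
  proof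
    fix i
    have "near x i (translate i x)"
      using x by (simp add: near_def X.nonperiodic_translate_in)
    then have "near x i (SOME z. near x i z)" by (rule someI[where P = "near x i"])
    then have "f (SOME z. near x i z) 0 = f (translate i x) 0"
      using x by (intro n) (auto simp: near_def X.nonperiodic_translate_in)
    then show "F x i = f x i" using f_translate[OF x] by (simp add: F_def)
  qed
  show thesis
  proof
    show "F x = f x" if "x \<in> nonperiodic_part X" for x using F_f that .
    show "F x i = F y i" if "\<forall>j\<in>{i - int n..i + int n}. x j = y j" for x y i using loc that .
    show "F (translate k x) = translate k (F x)" for x k
      by (simp add: fun_eq_iff F_def near_def add.assoc)
    fix x assume "x \<in> X"
    then obtain u where u: "converges u x" "\<And>n. u n \<in> nonperiodic_part X"
      using X.nonperiodic_dense by blast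
    have "converges (f \<circ> u) (F x)"
      unfolding converges_def
    proof
      fix i
      have "\<forall>\<^sub>F k in sequentially. \<forall>j\<in>{i - int n..i + int n}. u k j = x j"
        using u(1) by (rule converges_window)
      then show "\<forall>\<^sub>F k in sequentially. (f \<circ> u) k i = F x i"
      proof eventually_elim
        case (elim k)
        then show ?case using loc[OF elim] F_f[OF u(2)] by simp
      qed
    qed
    then show "F x \<in> Y" by (rule Y.limit_in) (use f_in[OF u(2)] in \<open>simp add: nonperiodic_part_def\<close>)
  qed
qed

end


section \<open>Conjugacies\<close>

lemma conjugacy_in: "conjugacy X Y f \<Longrightarrow> x \<in> X \<Longrightarrow> f x \<in> Y"
  unfolding conjugacy_def by (auto dest!: homeomorphic_imp_surjective_map)

lemma conjugacy_limit:
  assumes "conjugacy X Y f" "converges u x" "\<And>n. u n \<in> X" "x \<in> X"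
  shows "converges (f \<circ> u) (f x)"
  using assms continuous_map_converges homeomorphic_imp_continuous_map
  unfolding conjugacy_def by blast

lemma translate_Suc: "translate (int (Suc k)) x = shift (translate (int k) x)"
  by (simp add: fun_eq_iff shift_def algebra_simps)

lemma conjugacy_translate:
  assumes f: "conjugacy X Y f" and X: "\<And>x n. x \<in> X \<Longrightarrow> translate n x \<in> X" and x: "x \<in> X"
  shows "f (translate n x) = translate n (f x)"
proof -
  have nat: "f (translate (int k) y) = translate (int k) (f y)" if "y \<in> X" for k y
  proof (induction k)
    case (Suc k)
    have "f (shift (translate (int k) y)) = shift (f (translate (int k) y))"
      using f X that unfolding conjugacy_def by blast
    then show ?case unfolding translate_Suc Suc .
  qed simp
  show ?thesis
  proof (cases "n \<ge> 0")
    case True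
    then show ?thesis using nat[OF x, of "nat n"] by simp
  next
    case False
    \<comment> \<open>The nonnegative case is applied to \<open>translate n x\<close> and then
      undone.\<close>
    then have "f x = translate (- n) (f (translate n x))"
      using nat[OF X[OF x], of "nat (- n)" n] by simp
    then have "translate n (f x) = translate n (translate (- n) (f (translate n x)))" by simp
    then show ?thesis by simp
  qed
qed

lemma conjugacy_inverse:
  assumes f: "conjugacy X Y f" and X: "\<And>x n. x \<in> X \<Longrightarrow> translate n x \<in> X"
  obtains g where "conjugacy Y X g" "\<And>x. x \<in> X \<Longrightarrow> g (f x) = x" "\<And>y. y \<in> Y \<Longrightarrow> f (g y) = y"
proof -
  obtain g where g: "homeomorphic_maps (subtopology full_shift X) (subtopology full_shift Y) f g"
    using f unfolding conjugacy_def homeomorphic_map_maps by blast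
  have gf: "g (f x) = x" if "x \<in> X" for x using g that by (simp add: homeomorphic_maps_def)
  have fg: "f (g y) = y" if "y \<in> Y" for y using g that by (simp add: homeomorphic_maps_def)
  have g_hom: "homeomorphic_map (subtopology full_shift Y) (subtopology full_shift X) g"
    using g homeomorphic_maps_map homeomorphic_maps_sym by blast
  then have g_in: "g y \<in> X" if "y \<in> Y" for y
    using that by (auto dest!: homeomorphic_imp_surjective_map)
  have "g (shift y) = shift (g y)" if y: "y \<in> Y" for y
  proof -
    have "shift y = f (shift (g y))" using f g_in[OF y] fg[OF y] by (simp add: conjugacy_def)
    moreover have "shift (g y) \<in> X" using X[OF g_in[OF y]] by (simp add: shift_eq_translate)
    ultimately show ?thesis using gf by simp
  qed
  then have "conjugacy Y X g" using g_hom by (simp add: conjugacy_def)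
  then show thesis using that gf fg by blast
qed

lemma nonperiodic_conjugacyI:
  assumes "homoclinic_shift X M" "invariant_set Y"
    and f: "conjugacy (nonperiodic_part X) (nonperiodic_part Y) f"
    and g: "conjugacy (nonperiodic_part Y) (nonperiodic_part X) g"
    and gf: "\<And>x. x \<in> nonperiodic_part X \<Longrightarrow> g (f x) = x"
  shows "nonperiodic_conjugacy X M Y f g"
proof -
  interpret X: homoclinic_shift X M by fact
  interpret Y: invariant_set Y by fact
  show ?thesis
  proof
    show "converges (f \<circ> u) (f x)"
      if "converges u x" "\<And>n. u n \<in> nonperiodic_part X" "x \<in> nonperiodic_part X" for u x
      using f that by (rule conjugacy_limit)
    show "converges (g \<circ> v) (g y)"
      if "converges v y" "\<And>n. v n \<in> nonperiodic_part Y" "y \<in> nonperiodic_part Y" for v y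
      using g that by (rule conjugacy_limit)
    show "f (translate n x) = translate n (f x)" if "x \<in> nonperiodic_part X" for x n
      using f X.nonperiodic_translate_in that by (rule conjugacy_translate)
  qed (use conjugacy_in[OF f] conjugacy_in[OF g] gf in auto)
qed

text \<open>Density turns identities on nonperiodic points into identities on \<open>X\<close>: this
  serves both for the two extensions being mutually inverse and for uniqueness.\<close>

lemma (in homoclinic_shift) eq_on_nonperiodic_dense:
  assumes h: "\<And>u x. converges u x \<Longrightarrow> (\<And>n. u n \<in> X) \<Longrightarrow> x \<in> X \<Longrightarrow> converges (h \<circ> u) (h x)"
    and h': "\<And>u x. converges u x \<Longrightarrow> (\<And>n. u n \<in> X) \<Longrightarrow> x \<in> X \<Longrightarrow> converges (h' \<circ> u) (h' x)"
    and eq: "\<And>x. x \<in> nonperiodic_part X \<Longrightarrow> h x = h' x" and x: "x \<in> X"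
  shows "h x = h' x"
proof -
  obtain u where u: "converges u x" "\<And>n. u n \<in> nonperiodic_part X"
    using nonperiodic_dense x by blast
  then have "u n \<in> X" for n by (simp add: nonperiodic_part_def)
  then have "converges (h \<circ> u) (h x)" "converges (h' \<circ> u) (h' x)"
    using h h' u(1) x by blast+
  moreover have "h \<circ> u = h' \<circ> u" using eq u(2) by (simp add: fun_eq_iff)
  ultimately show ?thesis using converges_unique by metis
qed

lemma (in nonperiodic_conjugacy) continuous_extension:
  "\<exists>F. (\<forall>x\<in>nonperiodic_part X. F x = f x) \<and>
    continuous_map (subtopology full_shift X) (subtopology full_shift Y) F \<and>
    (\<forall>x. F (shift x) = shift (F x))"
proof -
  obtain F n where F: "\<And>x. x \<in> nonperiodic_part X \<Longrightarrow> F x = f x" "\<And>x. x \<in> X \<Longrightarrow> F x \<in> Y"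
    "\<And>x k. F (translate k x) = translate k (F x)"
    "\<And>x y i. \<forall>j\<in>{i - int n..i + int n}. x j = y j \<Longrightarrow> F x i = F y i"
    using sliding_block_extension by blast
  have cont: "continuous_map (subtopology full_shift X) (subtopology full_shift Y) F"
    by (rule continuous_map_sliding_block) (use F(2,4) in blast)+
  have shift: "F (shift x) = shift (F x)" for x
    unfolding shift_eq_translate by (rule F(3))
  show ?thesis using F(1) cont shift by blast
qed

theorem theorem1:
  fixes X :: "(int \<Rightarrow> 'a::finite) set" and Y :: "(int \<Rightarrow> 'b::finite) set"
    and \<phi>' :: "(int \<Rightarrow> 'a) \<Rightarrow> (int \<Rightarrow> 'b)"
  assumes "subshift_of_finite_type X" and "transitive_shift X" and "infinite X"
    and "subshift_of_finite_type Y" and "transitive_shift Y" and "infinite Y"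
    and "conjugacy (nonperiodic_part X) (nonperiodic_part Y) \<phi>'"
  shows "\<exists>\<phi>. conjugacy X Y \<phi> \<and> (\<forall>x\<in>nonperiodic_part X. \<phi> x = \<phi>' x) \<and>
    (\<forall>\<psi>. conjugacy X Y \<psi> \<and> (\<forall>x\<in>nonperiodic_part X. \<psi> x = \<phi>' x) \<longrightarrow>
          (\<forall>x\<in>X. \<psi> x = \<phi> x))"
proof -
  obtain M where "spliceable_shift X M" by (rule sft_spliceable[OF assms(1)])
  then have M: "homoclinic_shift X M" by (rule transitive_homoclinic[OF _ assms(2,3)])
  obtain N where "spliceable_shift Y N" by (rule sft_spliceable[OF assms(4)])
  then have N: "homoclinic_shift Y N" by (rule transitive_homoclinic[OF _ assms(5,6)])
  interpret X: homoclinic_shift X M by fact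
  interpret Y: homoclinic_shift Y N by fact
  obtain g where g: "conjugacy (nonperiodic_part Y) (nonperiodic_part X) g"
    "\<And>x. x \<in> nonperiodic_part X \<Longrightarrow> g (\<phi>' x) = x" "\<And>y. y \<in> nonperiodic_part Y \<Longrightarrow> \<phi>' (g y) = y"
    using conjugacy_inverse[OF assms(7) X.nonperiodic_translate_in] by blast
  interpret fw: nonperiodic_conjugacy X M Y \<phi>' g
    by (rule nonperiodic_conjugacyI[OF M Y.invariant_set_axioms assms(7) g(1,2)])
  \<comment> \<open>The hypotheses are symmetric in \<open>X\<close> and \<open>Y\<close>, so the
    inverse \<open>g\<close> extends by the same argument.\<close>
  interpret bw: nonperiodic_conjugacy Y N X g \<phi>'
    by (rule nonperiodic_conjugacyI[OF N X.invariant_set_axioms g(1) assms(7) g(3)])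
  obtain F where F: "\<And>x. x \<in> nonperiodic_part X \<Longrightarrow> F x = \<phi>' x"
    "continuous_map (subtopology full_shift X) (subtopology full_shift Y) F"
    "\<And>x. F (shift x) = shift (F x)"
    using fw.continuous_extension by blast
  obtain G where G: "\<And>y. y \<in> nonperiodic_part Y \<Longrightarrow> G y = g y"
    "continuous_map (subtopology full_shift Y) (subtopology full_shift X) G"
    using bw.continuous_extension by blast
  have GF: "G (F x) = x" if "x \<in> X" for x
  proof -
    have "(G \<circ> F) x = id x"
    proof (rule X.eq_on_nonperiodic_dense[OF _ _ _ that])
      show "converges (G \<circ> F \<circ> u) ((G \<circ> F) y)" if "converges u y" "\<And>n. u n \<in> X" "y \<in> X" for u y
        by (rule continuous_map_converges[OF continuous_map_compose[OF F(2) G(2)] that])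
      show "(G \<circ> F) y = id y" if "y \<in> nonperiodic_part X" for y
        using that F(1) G(1) fw.f_in g(2) by simp
    qed (simp add: o_def)
    then show ?thesis by simp
  qed
  have FG: "F (G y) = y" if "y \<in> Y" for y
  proof -
    have "(F \<circ> G) y = id y"
    proof (rule Y.eq_on_nonperiodic_dense[OF _ _ _ that])
      show "converges (F \<circ> G \<circ> u) ((F \<circ> G) x)" if "converges u x" "\<And>n. u n \<in> Y" "x \<in> Y" for u x
        by (rule continuous_map_converges[OF continuous_map_compose[OF G(2) F(2)] that])
      show "(F \<circ> G) x = id x" if "x \<in> nonperiodic_part Y" for x
        using that F(1) G(1) bw.f_in g(3) by simp
    qed (simp add: o_def)
    then show ?thesis by simp
  qed
  have "homeomorphic_maps (subtopology full_shift X) (subtopology full_shift Y) F G"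
    using F(2) G(2) GF FG by (simp add: homeomorphic_maps_def)
  then have "homeomorphic_map (subtopology full_shift X) (subtopology full_shift Y) F"
    unfolding homeomorphic_map_maps by blast
  then have conj: "conjugacy X Y F" using F(3) by (simp add: conjugacy_def)
  moreover have "\<psi> x = F x"
    if psi: "conjugacy X Y \<psi>" "\<forall>x\<in>nonperiodic_part X. \<psi> x = \<phi>' x" and x: "x \<in> X" for \<psi> x
  proof (rule X.eq_on_nonperiodic_dense[OF _ _ _ x])
    show "\<psi> y = F y" if "y \<in> nonperiodic_part X" for y using psi(2) F(1) that by simp
  qed (rule conjugacy_limit[OF psi(1)] conjugacy_limit[OF conj]; assumption)+
  ultimately show ?thesis using F(1) by blast
qed

end
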